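(* Let $n\ge2$, $\ell,\lambda>0$, and let $V,W,S$ be closed $k$-gons in $\mathbb{R}^n$ such that $\mathcal{B}_\ell(V,W)$ and $\mathcal{B}_\lambda(V,S)$ hold. Then there exists a closed $k$-gon $T$ in $\mathbb{R}^n$ such that $\mathcal{B}_\ell(S,T)$ and $\mathcal{B}_\lambda(W,T)$ hold.
   Context: A closed $k$-gon in $\mathbb{R}^n$ is a sequence of points $V_i$ with $V_{i+k}=V_i$ for all $i$. Discrete bicycle transport. Let $P,Q\in\mathbb{R}^n$, $\ell>0$, $\ell\ne|PQ|$, and let $X$ be a point with $|PX|=\ell$. Parallel translate $X$ along the vector $\overrightarrow{PQ}$ to $U=X+Q-P$ and reflect $U$ in the line $XQ$ (in the plane of $P,Q,X$) to obtain a point $Y$, the transport of $X$ along $PQ$; then $|QY|=\ell$ and $|XY|=|PQ|$. In terms of unit vectors $u=(X-P)/\ell$ and $v=(Y-Q)/\ell$ one has $v=\frac{2\,u\cdot\xi}{|\xi|^2}\,\xi-u$ with $\xi=(Q-P)-\ell u$. Discrete bicycle correspondence: $\mathcal{B}_\ell(V,W)$ means that for all $i$, $|V_iW_i|=\ell$ and $W_{i+1}$ is the transport of $W_i$ along $V_iV_{i+1}$. (Then $|W_iW_{i+1}|=|V_iV_{i+1}|$.) The length parameters $\ell$ and $\lambda$ are taken different from all side lengths of the polygons, so that transports are defined. *)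

theory Defs
  imports "HOL-Analysis.Analysis"
begin

definition closed_gon :: "nat \<Rightarrow> (int \<Rightarrow> 'a) \<Rightarrow> bool" where
  "closed_gon k V \<longleftrightarrow> (\<forall>i. V (i + int k) = V i)"

text \<open>The foot of the perpendicular from \<open>U\<close> to the line \<open>AB\<close> is the midpoint of \<open>U\<close> and its
  mirror image in that line.\<close>

definition line_reflection :: "'a \<Rightarrow> 'a \<Rightarrow> 'a \<Rightarrow> 'a::euclidean_space" where
  "line_reflection A B U = 2 *\<^sub>R closest_point (affine hull {A, B}) U - U"

text \<open>Meaningful only when \<open>dist P X \<noteq> dist P Q\<close>; this guarantees \<open>X \<noteq> Q\<close>, so that
  \<open>XQ\<close> is a line.\<close>

definition transport :: "'a \<Rightarrow> 'a \<Rightarrow> 'a \<Rightarrow> 'a::euclidean_space" where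
  "transport P Q X = line_reflection X Q (X + Q - P)"

text \<open>The conjunct \<open>l \<noteq> dist (V i) (V (i + 1))\<close> says that the transports are defined. As
  transport preserves side lengths, \<open>l\<close> then differs from the side lengths of \<open>W\<close> as well.\<close>

definition bicycle_corr :: "real \<Rightarrow> (int \<Rightarrow> 'a) \<Rightarrow> (int \<Rightarrow> 'a::euclidean_space) \<Rightarrow> bool" where
  "bicycle_corr l V W \<longleftrightarrow>
    (\<forall>i. dist (V i) (W i) = l \<and> l \<noteq> dist (V i) (V (i + 1))
       \<and> W (i + 1) = transport (V i) (V (i + 1)) (W i))"

lemma line_reflection_eq:
  fixes A B U :: "'a::euclidean_space"
  shows "line_reflection A B U =
    B + ((2 * ((U - B) \<bullet> (B - A))) / (norm (B - A))\<^sup>2) *\<^sub>R (B - A) - (U - B)"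
proof (cases "A = B")
  case True
  have "closest_point {B} U \<in> {B}" by (rule closest_point_in_set) auto
  then show ?thesis
    using True by (simp add: line_reflection_def algebra_simps scaleR_2)
next
  case False
  define d where "d = B - A"
  have d: "d \<bullet> d \<noteq> 0" using False by (simp add: d_def)
  define t where "t = ((U - B) \<bullet> d) / (d \<bullet> d)"
  define F where "F = B + t *\<^sub>R d"
  have FL: "F \<in> affine hull {A, B}"
    unfolding affine_hull_2_alt F_def d_def
    by (rule range_eqI[of _ _ "1 + t"]) (simp add: algebra_simps)
  have orth: "(U - F) \<bullet> d = 0"
    using d by (simp add: F_def t_def inner_diff_left inner_add_left)
  have "dist U F \<le> dist U z" if zL: "z \<in> affine hull {A, B}" for z
  proof -
    obtain s where "z = A + s *\<^sub>R d"
      using zL unfolding affine_hull_2_alt d_def by blast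
    then have z: "U - z = (U - F) + (1 + t - s) *\<^sub>R d"
      by (simp add: F_def d_def algebra_simps)
    have "(norm (U - z))\<^sup>2 = (norm (U - F))\<^sup>2 + (norm ((1 + t - s) *\<^sub>R d))\<^sup>2"
      unfolding z by (rule norm_add_Pythagorean) (simp add: orthogonal_def orth)
    then have "(norm (U - F))\<^sup>2 \<le> (norm (U - z))\<^sup>2" by simp
    then show ?thesis by (simp add: dist_norm)
  qed
  then have F: "F = closest_point (affine hull {A, B}) U"
    using FL by (intro closest_point_unique)
      (auto simp: affine_imp_convex closed_affine_hull)
  have "line_reflection A B U = B + (2 * t) *\<^sub>R d - (U - B)"
    unfolding line_reflection_def F[symmetric] F_def by (simp add: algebra_simps scaleR_2)
  then show ?thesis
    by (simp add: t_def d_def power2_norm_eq_inner)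
qed

lemma transport_unit_vector:
  fixes P Q u :: "'a::euclidean_space"
  assumes "l > 0"
  defines "\<xi> \<equiv> (Q - P) - l *\<^sub>R u"
  shows "transport P Q (P + l *\<^sub>R u) =
    Q + l *\<^sub>R (((2 * (u \<bullet> \<xi>)) / (norm \<xi>)\<^sup>2) *\<^sub>R \<xi> - u)"
proof -
  have "Q - (P + l *\<^sub>R u) = \<xi>" "P + l *\<^sub>R u + Q - P - Q = l *\<^sub>R u"
    by (simp_all add: \<xi>_def)
  then show ?thesis
    by (simp add: transport_def line_reflection_eq scaleR_diff_right algebra_simps)
qed

lemma dist_line_reflection:
  fixes A B U :: "'a::euclidean_space"
  shows "dist B (line_reflection A B U) = dist B U"
proof -
  define d where "d = B - A"
  define w where "w = U - B"
  define c where "c = (2 * (w \<bullet> d)) / (d \<bullet> d)"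
  have c: "c * (d \<bullet> d) = 2 * (w \<bullet> d)"
    by (cases "d = 0") (simp_all add: c_def)
  have "(norm (c *\<^sub>R d - w))\<^sup>2 = c * (c * (d \<bullet> d)) - 2 * c * (w \<bullet> d) + (norm w)\<^sup>2"
    by (simp add: power2_norm_eq_inner inner_diff_left inner_diff_right
        inner_commute[of d w] algebra_simps)
  then have "norm (c *\<^sub>R d - w) = norm w"
    by (simp add: c)
  moreover have "line_reflection A B U = B + (c *\<^sub>R d - w)"
    by (simp add: line_reflection_eq c_def d_def w_def power2_norm_eq_inner)
  moreover have "dist B (B + x) = norm x" for x
    by (simp add: dist_norm)
  ultimately show ?thesis
    by (simp add: dist_commute[of B U] dist_norm[of U B] w_def)
qed

lemma dist_transport: "dist Q (transport P Q X) = dist P X"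
proof -
  have "Q - (X + Q - P) = P - X" by simp
  then show ?thesis
    by (simp only: transport_def dist_line_reflection) (simp only: dist_norm)
qed

lemma line_reflection_commute: "line_reflection A B = line_reflection B A"
  by (simp add: line_reflection_def fun_eq_iff insert_commute)

lemma dist_transport_side: "dist X (transport P Q X) = dist P Q"
proof -
  have "dist X (transport P Q X) = dist X (X + Q - P)"
    unfolding transport_def by (subst line_reflection_commute) (rule dist_line_reflection)
  then show ?thesis by (simp add: dist_norm norm_minus_commute)
qed

end

theory Submission
  imports Defs
begin

text \<open>
  The polygon \<open>T\<close> is given by a local formula: \<open>T\<^sub>i\<close> is the transport of \<open>W\<^sub>i\<close> along \<open>V\<^sub>iS\<^sub>i\<close>. It is
  then automatically closed and has the right distances to \<open>S\<close> and \<open>W\<close>, and what remains is a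
  statement about one cube of points with bottom vertex \<open>V\<^sub>i\<close> and neighbouring vertices
  \<open>V\<^sub>i\<^sub>+\<^sub>1, W\<^sub>i, S\<^sub>i\<close>.

  The transport \<open>Y\<close> of \<open>X\<close> along \<open>PQ\<close> completes \<open>P, Q, X\<close> to an isosceles trapezoid: it is the
  mirror image of \<open>P\<close> in the perpendicular bisector of \<open>XQ\<close>. Hence
  \<open>Y - P = (|QP|\<^sup>2 - |XP|\<^sup>2) / |Q - X|\<^sup>2 \<cdot> (Q - X)\<close>, lemma \<open>transport_eq\<close>, a vector form of the
  discrete potential KdV equation. This expression is symmetric in \<open>Q\<close> and \<open>X\<close>, so each face of
  the cube is filled in the same way from any of its two edges. The three vertices adjacent to \<open>P\<close>
  determine those at distance two, and the eighth vertex can then be computed from three faces. The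
  three results agree because each equals one and the same barycentre of the three neighbours of
  \<open>P\<close> (lemmas \<open>transport_cube_barycentre\<close> and \<open>transport_cube_consistent\<close>); this is the
  three-dimensional consistency of the equation.

  The construction requires \<open>l \<noteq> lam\<close>, as otherwise the transport along \<open>V\<^sub>iS\<^sub>i\<close> may be degenerate.
  If \<open>l = lam\<close>, the polygon \<open>V\<close> itself can be taken for \<open>T\<close>, because the bicycle correspondence is
  symmetric (lemma \<open>bicycle_corr_sym\<close>).
\<close>

section \<open>Transport as reflection in a perpendicular bisector\<close>

text \<open>Reflecting \<open>P\<close> first in the midpoint of \<open>XQ\<close> and then in the line \<open>XQ\<close> amounts to reflecting
  it in the perpendicular bisector of \<open>XQ\<close>. The formula also holds for \<open>Q = X\<close>, where both sides
  are \<open>P\<close>.\<close>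

lemma transport_eq:
  fixes P Q X :: "'a::euclidean_space"
  shows "transport P Q X =
    P + (((dist P Q)\<^sup>2 - (dist P X)\<^sup>2) / (dist Q X)\<^sup>2) *\<^sub>R (Q - X)"
proof (cases "Q = X")
  case True
  then show ?thesis by (simp add: transport_def line_reflection_eq)
next
  case False
  define d where "d = Q - X"
  have d: "d \<bullet> d \<noteq> 0" using False by (simp add: d_def)
  have Q: "Q = X + d" by (simp add: d_def)
  have "(dist P Q)\<^sup>2 - (dist P X)\<^sup>2 = d \<bullet> d + 2 * ((X - P) \<bullet> d)"
    by (simp add: Q dist_norm power2_norm_eq_inner inner_simps inner_commute algebra_simps)
  moreover have "(dist Q X)\<^sup>2 = d \<bullet> d"
    by (simp add: d_def dist_norm power2_norm_eq_inner)
  ultimately have c: "((dist P Q)\<^sup>2 - (dist P X)\<^sup>2) / (dist Q X)\<^sup>2 =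
      1 + 2 * ((X - P) \<bullet> d) / (d \<bullet> d)"
    using d by (simp add: add_divide_distrib)
  have "transport P Q X = Q + (2 * ((X - P) \<bullet> d) / (d \<bullet> d)) *\<^sub>R d - (X - P)"
    by (simp add: transport_def line_reflection_eq d_def power2_norm_eq_inner)
  also have "\<dots> = P + (1 + 2 * ((X - P) \<bullet> d) / (d \<bullet> d)) *\<^sub>R d"
    by (simp add: Q scaleR_add_left)
  finally show ?thesis unfolding c d_def[symmetric] .
qed

lemma transport_commute:
  fixes P Q X :: "'a::euclidean_space"
  shows "transport P Q X = transport P X Q"
proof -
  have "transport P X Q =
      P + (- (((dist P Q)\<^sup>2 - (dist P X)\<^sup>2) / (dist Q X)\<^sup>2)) *\<^sub>R (- (Q - X))"
    by (simp add: transport_eq dist_commute[of X Q] minus_divide_left)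
  then show ?thesis by (simp only: transport_eq scaleR_minus_left scaleR_minus_right minus_minus)
qed

text \<open>The isosceles trapezoid on \<open>P, Q, X\<close> and the transported point may equally well be completed
  from its other three vertices.\<close>

lemma transport_transport:
  fixes P Q X :: "'a::euclidean_space"
  assumes "dist P Q \<noteq> dist P X"
  shows "transport X (transport P Q X) P = Q"
proof -
  define Y where "Y = transport P Q X"
  define D where "D = (dist Q X)\<^sup>2"
  define a where "a = (dist P Q)\<^sup>2 - (dist P X)\<^sup>2"
  define t where "t = a / D"
  have D: "D \<noteq> 0" using assms by (auto simp: D_def)
  have a: "a \<noteq> 0" using assms by (simp add: a_def)
  have YP: "Y - P = t *\<^sub>R (Q - X)"
    by (simp add: Y_def transport_eq t_def a_def D_def)
  have "(dist Y P)\<^sup>2 = t\<^sup>2 * D"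
    unfolding dist_norm[of Y P] YP by (simp add: power_mult_distrib D_def dist_norm)
  moreover have "dist X Y = dist P Q"
    by (simp add: Y_def dist_transport_side)
  ultimately have "transport X Y P = X + (a / (t\<^sup>2 * D)) *\<^sub>R (Y - P)"
    by (simp add: transport_eq[of X Y P] a_def dist_commute[of X P])
  also have "\<dots> = X + (a / (t\<^sup>2 * D) * t) *\<^sub>R (Q - X)"
    by (simp add: YP)
  also have "a / (t\<^sup>2 * D) * t = 1"
    using D a by (simp add: t_def field_simps power2_eq_square)
  finally show ?thesis by (simp add: Y_def)
qed

lemma bicycle_corr_sym:
  fixes V W :: "int \<Rightarrow> 'a::euclidean_space"
  assumes "bicycle_corr l V W"
  shows "bicycle_corr l W V"
  unfolding bicycle_corr_def
proof
  fix i
  have d: "dist (V i) (W i) = l" "l \<noteq> dist (V i) (V (i + 1))"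
    and W: "W (i + 1) = transport (V i) (V (i + 1)) (W i)"
    using assms unfolding bicycle_corr_def by blast+
  have "transport (W i) (W (i + 1)) (V i) = V (i + 1)"
    unfolding W by (rule transport_transport) (use d in simp)
  then show "dist (W i) (V i) = l \<and> l \<noteq> dist (W i) (W (i + 1)) \<and>
      V (i + 1) = transport (W i) (W (i + 1)) (V i)"
    using d by (simp add: W dist_transport_side dist_commute[of "W i"])
qed

section \<open>Three-dimensional consistency\<close>

text \<open>Unnormalised barycentric weight of \<open>x\<close> in the vertex opposite to \<open>P\<close> of the cube spanned by
  \<open>P\<close> and its neighbours \<open>x, y, z\<close>. It is symmetric in \<open>y\<close> and \<open>z\<close>, so that permuting the three
  neighbours permutes the three weights.\<close>

definition cube_weight :: "'a::euclidean_space \<Rightarrow> 'a \<Rightarrow> 'a \<Rightarrow> 'a \<Rightarrow> real" where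
  "cube_weight P x y z =
    ((dist P x)\<^sup>2 - (dist P y)\<^sup>2) * ((dist P x)\<^sup>2 - (dist P z)\<^sup>2) * (dist y z)\<^sup>2"

lemma cube_weight_commute: "cube_weight P x y z = cube_weight P x z y"
  by (simp add: cube_weight_def dist_commute[of y z] mult.commute)

text \<open>The two faces at \<open>P\<close> that contain \<open>x\<close> give the neighbours of \<open>x\<close>. With \<open>N\<close> the
  difference of these neighbours and \<open>g = |Pz|\<^sup>2 - |Py|\<^sup>2\<close>, the eighth vertex is
  \<open>x + g / |N|\<^sup>2 \<cdot> N\<close>. By the polarisation identity, \<open>|xy|\<^sup>2 |xz|\<^sup>2 |N|\<^sup>2\<close> is the sum of the
  weights. The sum vanishes only if \<open>N = 0\<close>, which is excluded because the two neighbours have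
  the different distances \<open>|Py|\<close> and \<open>|Pz|\<close> to \<open>x\<close>.\<close>

lemma transport_cube_barycentre:
  fixes P x y z :: "'a::euclidean_space"
  assumes xy: "dist P x \<noteq> dist P y" and xz: "dist P x \<noteq> dist P z" and yz: "dist P y \<noteq> dist P z"
  defines "m \<equiv> cube_weight P x y z + cube_weight P y z x + cube_weight P z x y"
  shows "m \<noteq> 0"
    and "m *\<^sub>R transport x (transport P x y) (transport P x z) =
      cube_weight P x y z *\<^sub>R x + cube_weight P y z x *\<^sub>R y + cube_weight P z x y *\<^sub>R z"
proof -
  define a where "a = (dist P y)\<^sup>2 - (dist P x)\<^sup>2"
  define b where "b = (dist P z)\<^sup>2 - (dist P x)\<^sup>2"
  define g where "g = (dist P z)\<^sup>2 - (dist P y)\<^sup>2"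
  define u where "u = y - x"
  define v where "v = z - x"
  define X where "X = (dist x y)\<^sup>2"
  define Y where "Y = (dist x z)\<^sup>2"
  define Z where "Z = (dist y z)\<^sup>2"
  define N where "N = (b / Y) *\<^sub>R v - (a / X) *\<^sub>R u"
  define Ty where "Ty = transport P x y"
  define Tz where "Tz = transport P x z"
  have g: "g = b - a" by (simp add: g_def b_def a_def)
  have X: "X \<noteq> 0" and Y: "Y \<noteq> 0" using xy xz by (auto simp: X_def Y_def)
  have Xu: "X = u \<bullet> u" and Yv: "Y = v \<bullet> v"
    by (simp_all add: X_def Y_def u_def v_def dist_norm norm_minus_commute[of x]
        flip: power2_norm_eq_inner)
  have uv: "2 * (u \<bullet> v) = X + Y - Z"
  proof -
    have "y - z = u - v" by (simp add: u_def v_def)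
    then show ?thesis
      by (simp add: Xu Yv Z_def dist_norm power2_norm_eq_inner inner_simps inner_commute)
  qed
  have wx: "cube_weight P x y z = a * b * Z"
    by (simp add: cube_weight_def a_def b_def Z_def algebra_simps)
  have wy: "cube_weight P y z x = - (a * g * Y)"
    by (simp add: cube_weight_def a_def g_def Y_def dist_commute[of z x] algebra_simps)
  have wz: "cube_weight P z x y = b * g * X"
    by (simp add: cube_weight_def b_def g_def X_def)
  have Ty: "Ty - P = (a / X) *\<^sub>R u"
  proof -
    have "Ty - P = (- (a / X)) *\<^sub>R (- u)"
      by (simp only: Ty_def transport_eq a_def X_def u_def minus_divide_left minus_diff_eq
          add_diff_cancel_left')
    then show ?thesis by simp
  qed
  have Tz: "Tz - P = (b / Y) *\<^sub>R v"
  proof -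
    have "Tz - P = (- (b / Y)) *\<^sub>R (- v)"
      by (simp only: Tz_def transport_eq b_def Y_def v_def minus_divide_left minus_diff_eq
          add_diff_cancel_left')
    then show ?thesis by simp
  qed
  have N: "Tz - Ty = N"
    using Ty Tz by (simp add: N_def algebra_simps)
  have dy: "dist x Ty = dist P y" and dz: "dist x Tz = dist P z"
    by (simp_all add: Ty_def Tz_def dist_transport)
  have "N \<noteq> 0" using N dy dz yz by auto
  have NN: "N \<bullet> N * (X * Y) = m"
  proof -
    have "N \<bullet> N = (b / Y)\<^sup>2 * Y + (a / X)\<^sup>2 * X - (a / X) * (b / Y) * (2 * (u \<bullet> v))"
      by (simp add: N_def Xu Yv inner_simps inner_commute power2_eq_square)
    also have "\<dots> * (X * Y) = b\<^sup>2 * X + a\<^sup>2 * Y - a * b * (X + Y - Z)"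
      unfolding uv using X Y by (simp add: field_simps power2_eq_square)
    also have "\<dots> = m"
      by (simp add: m_def wx wy wz g algebra_simps power2_eq_square)
    finally show ?thesis .
  qed
  show m: "m \<noteq> 0" using NN X Y \<open>N \<noteq> 0\<close> by auto
  have "Ty - Tz = - N" using N by (simp flip: N)
  then have "transport x Ty Tz = x + (- g / (N \<bullet> N)) *\<^sub>R (- N)"
    by (simp only: transport_eq dy dz g_def minus_diff_eq dist_norm[of Ty] norm_minus_cancel
        power2_norm_eq_inner)
  also have "\<dots> = x + (g * (X * Y) / m) *\<^sub>R N"
    using X Y by (simp add: NN[symmetric])
  finally have "m *\<^sub>R transport x Ty Tz = m *\<^sub>R x + (g * (X * Y)) *\<^sub>R N"
    using m by (simp add: scaleR_add_right)
  also have "(g * (X * Y)) *\<^sub>R N = (b * g * X) *\<^sub>R v - (a * g * Y) *\<^sub>R u"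
    using X Y by (simp add: N_def scaleR_diff_right mult_ac)
  also have "m *\<^sub>R x + \<dots> = (m - b * g * X + a * g * Y) *\<^sub>R x - (a * g * Y) *\<^sub>R y + (b * g * X) *\<^sub>R z"
    by (simp add: u_def v_def algebra_simps)
  also have "m - b * g * X + a * g * Y = a * b * Z"
    by (simp add: m_def wx wy wz)
  finally show "m *\<^sub>R transport x (transport P x y) (transport P x z) =
      cube_weight P x y z *\<^sub>R x + cube_weight P y z x *\<^sub>R y + cube_weight P z x y *\<^sub>R z"
    by (simp add: wx wy wz Ty_def Tz_def)
qed

lemma transport_cube_consistent:
  fixes P x y z :: "'a::euclidean_space"
  assumes "dist P x \<noteq> dist P y" "dist P x \<noteq> dist P z" "dist P y \<noteq> dist P z"
  shows "transport x (transport P x y) (transport P x z) =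
    transport y (transport P x y) (transport P y z)"
proof -
  define m where "m = cube_weight P x y z + cube_weight P y z x + cube_weight P z x y"
  have "m \<noteq> 0"
    using transport_cube_barycentre(1)[OF assms] by (simp add: m_def)
  moreover have "m *\<^sub>R transport x (transport P x y) (transport P x z) =
      m *\<^sub>R transport y (transport P x y) (transport P y z)"
    using transport_cube_barycentre(2)[of P x y z] transport_cube_barycentre(2)[of P y x z] assms
    by (simp add: m_def transport_commute[of P y x] cube_weight_commute[of P _ z]
        cube_weight_commute[of P z y] add_ac)
  ultimately show ?thesis by simp
qed

section \<open>Permutability of bicycle correspondences\<close>

text \<open>Applied to the cube over the edge \<open>V\<^sub>iV\<^sub>i\<^sub>+\<^sub>1\<close>, consistency says that transporting the fourth
  vertex along \<open>S\<^sub>iS\<^sub>i\<^sub>+\<^sub>1\<close> gives the fourth vertex of the next trapezoid. Exchanging the roles of \<open>W\<close>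
  and \<open>S\<close> does not change that fourth vertex, so this one half of the claim yields the other.\<close>

lemma bicycle_corr_fourth_polygon:
  fixes V W S :: "int \<Rightarrow> 'a::euclidean_space"
  assumes W: "bicycle_corr l V W" and S: "bicycle_corr lam V S" and "l \<noteq> lam"
  shows "bicycle_corr l S (\<lambda>i. transport (V i) (S i) (W i))"
  unfolding bicycle_corr_def
proof
  fix i
  have dW: "dist (V i) (W i) = l" "l \<noteq> dist (V i) (V (i + 1))"
    and W': "W (i + 1) = transport (V i) (V (i + 1)) (W i)"
    using W unfolding bicycle_corr_def by blast+
  have dS: "dist (V i) (S i) = lam" "lam \<noteq> dist (V i) (V (i + 1))"
    and S': "S (i + 1) = transport (V i) (V (i + 1)) (S i)"
    using S unfolding bicycle_corr_def by blast+
  have "transport (V (i + 1)) (S (i + 1)) (W (i + 1)) =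
      transport (S i) (S (i + 1)) (transport (V i) (S i) (W i))"
    unfolding W' S' by (rule transport_cube_consistent) (use dW dS \<open>l \<noteq> lam\<close> in auto)
  then show "dist (S i) (transport (V i) (S i) (W i)) = l \<and> l \<noteq> dist (S i) (S (i + 1)) \<and>
      transport (V (i + 1)) (S (i + 1)) (W (i + 1)) =
      transport (S i) (S (i + 1)) (transport (V i) (S i) (W i))"
    using dW by (simp add: dist_transport S' dist_transport_side)
qed

theorem theorem3:
  fixes V W S :: "int \<Rightarrow> real ^ 'n" and k :: nat and l lam :: real
  assumes "CARD('n) \<ge> 2" and "k \<ge> 1" and "l > 0" and "lam > 0"
    and "closed_gon k V" and "closed_gon k W" and "closed_gon k S"
    and "bicycle_corr l V W" and "bicycle_corr lam V S"
  shows "\<exists>T :: int \<Rightarrow> real ^ 'n. closed_gon k T \<and> bicycle_corr l S T \<and> bicycle_corr lam W T"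
proof (cases "l = lam")
  case True
  then show ?thesis
    using assms bicycle_corr_sym by blast
next
  case False
  define T where "T = (\<lambda>i. transport (V i) (S i) (W i))"
  have "closed_gon k T"
    using assms by (simp add: closed_gon_def T_def)
  moreover have "bicycle_corr l S T"
    unfolding T_def using assms False by (intro bicycle_corr_fourth_polygon)
  moreover have "bicycle_corr lam W T"
    unfolding T_def transport_commute[of _ "S _"]
    using assms False by (intro bicycle_corr_fourth_polygon) auto
  ultimately show ?thesis by blast
qed

end
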